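(* Let $n,s$ be positive integers with $s^2\equiv 1 \pmod n$ and $s\not\equiv \pm 1 \pmod n$. Suppose that $n=n_1n_2$ where $n_1,n_2\ge 3$ are coprime integers with $s\equiv -1 \pmod{n_1}$ and $s\equiv 1\pmod{n_2}$, and suppose moreover that $n_1\in\{3,5\}$ and $n_2$ is even. Then $$\mathsf D_{\{1,s\}}(C_n)=n_2+\lfloor\log_2(n_1)\rfloor.$$
   Context: $C_m$ denotes the cyclic group of order $m$, written additively. A sequence over a finite abelian group $G$ is a finite unordered list of elements of $G$ with repetition allowed; its length is the number of terms counted with multiplicity. For a finite abelian group $G$ and a non-empty set $A\subset\mathbb Z$ containing no multiple of the exponent of $G$, the $A$-weighted Davenport constant $\mathsf D_A(G)$ is the smallest positive integer $D$ such that every sequence of length $D$ over $G$ has a non-empty subsequence $x_1,\dots,x_t$ with $\varepsilon_1x_1+\dots+\varepsilon_tx_t=0$ for some $\varepsilon_1,\dots,\varepsilon_t\in A$. *)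

theory Defs
  imports Complex_Main "HOL-Library.Multiset" "HOL-Number_Theory.Cong"
    "HOL-Algebra.FiniteProduct" "HOL-Algebra.Elementary_Groups"
begin

text \<open>
  A sequence over \<open>G\<close> is a multiset of elements of \<open>carrier G\<close>. In HOL-Algebra a commutative
  group is written multiplicatively, so the integer multiple \<open>\<epsilon> x\<close> is
  \<open>x [^]\<^bsub>G\<^esub> \<epsilon>\<close> with \<open>\<epsilon> :: int\<close>, and a sum is a \<open>finprod\<close>. The terms of the chosen
  subsequence are enumerated by a list \<open>xs\<close>, since equal terms may receive different weights.
\<close>

definition has_weighted_zero_sum :: "int set \<Rightarrow> ('a, 'b) monoid_scheme \<Rightarrow> 'a multiset \<Rightarrow> bool" where
  "has_weighted_zero_sum A G S \<longleftrightarrow>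
     (\<exists>xs es. xs \<noteq> [] \<and> mset xs \<subseteq># S \<and> length es = length xs \<and> set es \<subseteq> A \<and>
        finprod G (\<lambda>i. (xs ! i) [^]\<^bsub>G\<^esub> (es ! i)) {..<length xs} = \<one>\<^bsub>G\<^esub>)"

text \<open>
  Intended for finite commutative \<open>G\<close> and non-empty \<open>A\<close>, where an admissible length always
  exists: a long enough sequence contains \<open>exp(G)\<close> copies of a single element, and these have
  sum zero when all given the same weight.
\<close>

definition weighted_davenport :: "int set \<Rightarrow> ('a, 'b) monoid_scheme \<Rightarrow> nat" where
  "weighted_davenport A G =
     (LEAST D. D > 0 \<and>
        (\<forall>S. set_mset S \<subseteq> carrier G \<and> size S = D \<longrightarrow> has_weighted_zero_sum A G S))"

end

theory Submission
  imports Defs "HOL-Library.Numeral_Type" "HOL-Library.Product_Plus"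
begin

text \<open>
  By the Chinese remainder theorem $C_n = C_{n_1} \<oplus> C_{n_2}$, and multiplication by \<open>s\<close> acts as \<open>- 1\<close> on
  the first summand and trivially on the second. So a weighted zero sum is a subsequence whose
  second components sum to \<open>0\<close> and whose first components cancel for a suitable choice of signs.

  For the upper bound, signs can be chosen as soon as the number of terms with first component
  \<open>\<plusminus> 1\<close> and the number with first component \<open>\<plusminus> 2\<close> are both even, and modulo \<open>3\<close> or \<open>5\<close> every other
  term has first component \<open>0\<close>. Recording these parities turns the problem into an unweighted one in
  $C_2 \<oplus> C_{n_2}$ for \<open>n1 = 3\<close>, and in $C_2^2 \<oplus> C_{n_2}$ for \<open>n1 = 5\<close>. As \<open>n2 = 2 * k\<close> is even, the
  Davenport constants of these groups are \<open>n2 + 1\<close> and \<open>n2 + 2\<close>, which are the required values.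

  The bound for $C_2^2 \<oplus> C_{2k}$ is \<open>zero_sum_C2_C2_C2k\<close>. In the quotient $C_2^3$, disjoint blocks of
  sum zero are split off; their sums lie in a group of order \<open>k\<close>, so that \<open>k\<close> blocks suffice. Among
  eight terms there is always a block of at most two. This greedy procedure yields \<open>k\<close> blocks,
  except that it may stop with \<open>k - 2\<close> blocks and six terms whose images are distinct and non-zero.
  Then no two disjoint blocks are left, but the sums of the seven blocks of three or
  four terms among the six satisfy a linear relation (\<open>six_point_configuration\<close>) that forbids all of
  them to hit the only value that does not complete a zero sum.

  For the lower bound, take \<open>n2 - 1\<close> terms \<open>(0, 1)\<close>, the term \<open>(1, 0)\<close>, and for \<open>n1 = 5\<close> also \<open>(2, 0)\<close>:
  the terms \<open>(0, 1)\<close> cannot occur in a zero sum, and the others do not cancel.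
\<close>

section \<open>Zero sums with values in a group of type $C_2^3$\<close>

text \<open>
  There are more subsets than group elements, so two of them have equal sums; where every
  element is its own inverse, the sum over their symmetric difference vanishes.
\<close>

lemma zero_sum_subset_if_double_eq_0:
  fixes c :: "'i \<Rightarrow> 'v::{ab_group_add,finite}"
  assumes char2: "\<And>x::'v. x + x = 0" and I: "finite I" "CARD('v) < 2 ^ card I"
  shows "\<exists>J\<subseteq>I. J \<noteq> {} \<and> sum c J = 0"
proof -
  have "\<not> inj_on (sum c) (Pow I)"
  proof
    assume "inj_on (sum c) (Pow I)"
    then have "card (Pow I) \<le> card (UNIV :: 'v set)"
      by (intro card_inj_on_le[of "sum c"]) auto
    then show False
      using I by (simp add: card_Pow)
  qed
  then obtain J K where JK: "J \<subseteq> I" "K \<subseteq> I" "J \<noteq> K" "sum c J = sum c K"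
    by (auto simp: inj_on_def)
  have fin: "finite J" "finite K"
    using JK I finite_subset by blast+
  have "sum c J = sum c (J - K) + sum c (J \<inter> K)" "sum c K = sum c (K - J) + sum c (J \<inter> K)"
    using fin by (metis add.commute sum.Int_Diff, metis Int_commute add.commute sum.Int_Diff)
  then have "sum c (J - K) = sum c (K - J)"
    using JK by simp
  moreover have "sum c ((J - K) \<union> (K - J)) = sum c (J - K) + sum c (K - J)"
    using fin by (intro sum.union_disjoint) auto
  ultimately have "sum c ((J - K) \<union> (K - J)) = 0"
    using char2 by simp
  moreover have "(J - K) \<union> (K - J) \<subseteq> I" "(J - K) \<union> (K - J) \<noteq> {}"
    using JK by auto
  ultimately show ?thesis
    by blast
qed

text \<open>
  If the translate stayed inside \<open>A\<close>, then \<open>A\<close> would contain, starting from \<open>0\<close>, every multiple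
  of \<open>b\<close> modulo \<open>M\<close>, and in particular \<open>(M - 1) * b\<close>, which is \<open>- b\<close> modulo \<open>M\<close>.
\<close>

lemma card_less_card_Un_translate:
  fixes A :: "int set" and M b :: int
  assumes M: "0 < M" and A: "A \<subseteq> {0..<M}" "0 \<in> A" and b: "(- b) mod M \<notin> A"
  shows "card A < card (A \<union> (\<lambda>a. (a + b) mod M) ` A)"
proof -
  have fin: "finite A"
    using A finite_subset by blast
  have "\<not> (\<lambda>a. (a + b) mod M) ` A \<subseteq> A"
  proof
    assume sub: "(\<lambda>a. (a + b) mod M) ` A \<subseteq> A"
    have "(int t * b) mod M \<in> A" for t
    proof (induction t)
      case 0
      show ?case using A by simp
    next
      case (Suc t)
      then have "((int t * b) mod M + b) mod M \<in> A"
        using sub by blast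
      then show ?case
        by (simp add: mod_add_left_eq mod_add_right_eq algebra_simps)
    qed
    from this[of "nat (M - 1)"] have "((M - 1) * b) mod M \<in> A"
      using M by simp
    moreover have "((M - 1) * b) mod M = (- b) mod M"
      using mod_mult_self2[of "- b" M b] by (simp add: algebra_simps)
    ultimately show False
      using b by simp
  qed
  then have "A \<subset> A \<union> (\<lambda>a. (a + b) mod M) ` A"
    by blast
  then show ?thesis
    using fin by (intro psubset_card_mono) auto
qed

lemma card_even_residues: "card {x \<in> {0..<2 * int k}. even x} = k"
proof -
  have "{x \<in> {0..<2 * int k}. even x} = (\<lambda>x. 2 * x) ` {0..<int k}"
    by (auto elim!: evenE)
  then show ?thesis
    by (simp add: card_image inj_on_def)
qed

text \<open>
  The eight elements are listed as the four cosets of \<open>{0, p}\<close>, represented by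
  \<open>0\<close>, \<open>q\<close>, \<open>r\<close> and \<open>q + r\<close>.
\<close>

lemma coset_representatives_of_order_2_subgroup:
  fixes p :: "'v::{ab_group_add,finite}"
  assumes char2: "\<And>x::'v. x + x = 0" and card: "CARD('v) = 8" and p: "p \<noteq> 0"
  obtains q r where "distinct [0, p, q, q + p, r, r + p, q + r, q + r + p]"
proof -
  have "card {0, p} < CARD('v)"
    using card p by simp
  then have "{0, p} \<noteq> UNIV"
    by (metis less_irrefl)
  then obtain q where q: "q \<notin> {0, p}" by blast
  have "card {0, p, q, q + p} \<le> 4"
    by (simp add: card_insert_if)
  then have "{0, p, q, q + p} \<noteq> UNIV"
    using card by auto
  then obtain r where r: "r \<notin> {0, p, q, q + p}" by blast
  have eq: "x + y = 0 \<longleftrightarrow> x = y" for x y :: 'v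
    using char2 by (metis add_left_cancel)
  have "distinct [0, p, q, q + p, r, r + p, q + r, q + r + p]"
    using p q r by (auto simp: eq add_ac)
  then show ?thesis by (rule that)
qed

text \<open>
  The non-zero elements of a group of type $C_2^3$ are the points of the Fano plane. Remove the
  point \<open>p\<close>. Four lines avoid \<open>p\<close>, and each of the six remaining points lies on two of them.
  The complements of the three lines through \<open>p\<close> are three zero-sum quadruples, and again each
  of the six points lies in two of them. The sum over all lines and the sum over all quadruples
  therefore both equal \<open>2 * \<sigma>\<close>, where \<open>\<sigma>\<close> is the sum over the six points. If all seven
  individual sums are congruent to \<open>- h\<close>, this gives \<open>4 * h \<equiv> 3 * h\<close>.
\<close>

lemma six_point_configuration:
  fixes F :: "'v::{ab_group_add,finite} \<Rightarrow> int"
  assumes char2: "\<And>x::'v. x + x = 0" and card: "CARD('v) = 8" and p: "p \<noteq> 0"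
    and all: "\<And>T. T \<subseteq> UNIV - {0, p} \<Longrightarrow> T \<noteq> {} \<Longrightarrow> \<Sum>T = 0 \<Longrightarrow> (- sum F T) mod M = h"
  shows "h mod M = 0"
proof -
  obtain q r where d: "distinct [0, p, q, q + p, r, r + p, q + r, q + r + p]"
    using coset_representatives_of_order_2_subgroup[OF char2 card p] .
  have char2': "x + (x + y) = y" for x y :: 'v
    using char2 by (metis add.assoc add_0)
  note z = char2 char2' add_ac
  have lines:
    "(- sum F {q, r, q + r}) mod M = h"
    "(- sum F {q, r + p, q + r + p}) mod M = h"
    "(- sum F {q + p, r, q + r + p}) mod M = h"
    "(- sum F {q + p, r + p, q + r}) mod M = h"
    by (rule all; use d in \<open>force simp: z\<close>)+
  have quads:
    "(- sum F {q, q + p, r, r + p}) mod M = h"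
    "(- sum F {q, q + p, q + r, q + r + p}) mod M = h"
    "(- sum F {r, r + p, q + r, q + r + p}) mod M = h"
    by (rule all; use d in \<open>force simp: z\<close>)+
  define \<sigma> where "\<sigma> = F q + F (q + p) + F r + F (r + p) + F (q + r) + F (q + r + p)"
  have "- (2 * \<sigma>) = - sum F {q, r, q + r} + - sum F {q, r + p, q + r + p}
      + - sum F {q + p, r, q + r + p} + - sum F {q + p, r + p, q + r}"
    using d by (simp add: \<sigma>_def)
  also have "[\<dots> = h + h + h + h] (mod M)"
    using lines by (intro cong_add) (auto simp: cong_def)
  finally have "[- (2 * \<sigma>) = 4 * h] (mod M)" by simp
  moreover have "[- (2 * \<sigma>) = 3 * h] (mod M)"
  proof -
    have "- (2 * \<sigma>) = - sum F {q, q + p, r, r + p} + - sum F {q, q + p, q + r, q + r + p}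
        + - sum F {r, r + p, q + r, q + r + p}"
      using d by (simp add: \<sigma>_def)
    also have "[\<dots> = h + h + h] (mod M)"
      using quads by (intro cong_add) (auto simp: cong_def)
    finally show ?thesis by simp
  qed
  ultimately have "[4 * h = 3 * h] (mod M)"
    using cong_sym cong_trans by blast
  then have "M dvd 4 * h - 3 * h"
    by (simp add: cong_iff_dvd_diff)
  then show ?thesis by simp
qed

text \<open>
  This is the upper bound $2k + 2$ for the Davenport constant of $C_2^2 \<oplus> C_{2k}$ in a form that can
  be proved by induction. The value of \<open>c\<close> is the image of a term in the quotient $C_2^3$, in which
  the sum of \<open>f\<close> is only seen modulo \<open>2\<close>; by \<open>par\<close>, a set \<open>J\<close> with \<open>sum c J = 0\<close> has an even sum.
  The set \<open>A\<close> stands for the sums of \<open>f\<close> over unions of blocks that have already been split off,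
  a block being a set on which \<open>c\<close> sums to \<open>0\<close>.

  Splitting off a block of at most two terms costs at most two terms and makes \<open>A\<close> grow, unless
  the wanted sum has been found; this is why \<open>card A\<close> and \<open>j\<close> are traded one for one against two
  terms. At \<open>j = 1\<close> the set \<open>A\<close> consists of all even residues, so any block will do, and \<open>j = 0\<close> is
  impossible because there are only \<open>k\<close> even residues. A block of at most two terms exists unless
  the values of \<open>c\<close> are distinct and non-zero. For \<open>j \<ge> 2\<close> at least six terms are left, and only
  seven such values exist; so this leaves \<open>j = 2\<close>, where at most one even residue is missing from
  \<open>A\<close> and the six-point configuration applies.
\<close>

lemma zero_sum_subset_hitting:
  fixes c :: "'i \<Rightarrow> 'v::{ab_group_add,finite}" and f :: "'i \<Rightarrow> int" and k j :: nat
  assumes char2: "\<And>x::'v. x + x = 0" and card: "CARD('v) = 8"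
    and par: "\<And>J. finite J \<Longrightarrow> sum c J = 0 \<Longrightarrow> even (sum f J)" and k: "k > 0"
    and "finite I" and "2 * j + 2 \<le> card I"
    and "A \<subseteq> {x \<in> {0..<2 * int k}. even x}" and "0 \<in> A" and "k + 1 \<le> card A + j"
  shows "\<exists>J\<subseteq>I. J \<noteq> {} \<and> sum c J = 0 \<and> (- sum f J) mod (2 * int k) \<in> A"
  using assms(5-)
proof (induction j arbitrary: I A)
  let ?M = "2 * int k" and ?E = "{x \<in> {0..<2 * int k}. even x}"
  have finE: "finite ?E"
    by (rule finite_subset[of _ "{0..<2 * int k}"]) auto
  have mod_E: "(- sum f J) mod ?M \<in> ?E" if "finite J" "sum c J = 0" for J
    using par[OF that] k by (auto simp: dvd_mod_iff)
  have card_le: "card A \<le> k" if "A \<subseteq> ?E" for A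
  proof -
    have "card A \<le> card ?E"
      by (rule card_mono[OF finE that])
    then show ?thesis by (simp only: card_even_residues)
  qed
  {
    case 0
    then show ?case
      using card_le[of A] by simp
  next
    case (Suc j)
    note fin = \<open>finite I\<close> and A = \<open>A \<subseteq> ?E\<close> \<open>0 \<in> A\<close>
    have finA: "finite A"
      using A(1) finE by (rule finite_subset)
    show ?case
    proof (cases "\<exists>B\<subseteq>I. B \<noteq> {} \<and> card B \<le> 2 \<and> sum c B = 0")
      case True
      then obtain B where B: "B \<subseteq> I" "B \<noteq> {}" "card B \<le> 2" "sum c B = 0" by blast
      have finB: "finite B" using B fin finite_subset by blast
      show ?thesis
      proof (cases "(- sum f B) mod ?M \<in> A")
        case True
        then show ?thesis using B by blast
      next
        case False
        \<comment> \<open>a solution for the enlarged set either solves the problem for \<open>A\<close>, or does so with \<open>B\<close> added\<close>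
        let ?A = "A \<union> (\<lambda>a. (a + sum f B) mod ?M) ` A"
        have evB: "even (sum f B)"
          using par finB B by blast
        have "card A < card ?A"
          by (rule card_less_card_Un_translate) (use A False k in auto)
        moreover have "?A \<subseteq> ?E"
          using A k evB by (auto simp: dvd_mod_iff)
        moreover have "card I = card B + card (I - B)"
          using B finB fin by (simp add: card_Diff_subset card_mono)
        ultimately have "\<exists>J\<subseteq>I - B. J \<noteq> {} \<and> sum c J = 0 \<and> (- sum f J) mod ?M \<in> ?A"
          using Suc.prems B(3) by (intro Suc.IH) auto
        then obtain J where J: "J \<subseteq> I - B" "J \<noteq> {}" "sum c J = 0" "(- sum f J) mod ?M \<in> ?A"
          by blast
        have finJ: "finite J"
          using J fin finite_subset by blast
        show ?thesis
        proof (cases "(- sum f J) mod ?M \<in> A")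
          case True
          then show ?thesis using J by blast
        next
          case False
          then obtain a where a: "a \<in> A" "(- sum f J) mod ?M = (a + sum f B) mod ?M"
            using J by blast
          have un: "sum g (J \<union> B) = sum g J + sum g B" for g :: "'i \<Rightarrow> 'x::comm_monoid_add"
            using J finB finJ by (intro sum.union_disjoint) auto
          have "(- sum f J - sum f B) mod ?M = (a + sum f B - sum f B) mod ?M"
            using a(2) by (rule mod_diff_cong) simp
          then have "(- sum f (J \<union> B)) mod ?M = a"
            using a A by (auto simp: un)
          moreover have "sum c (J \<union> B) = 0"
            using J B by (simp add: un)
          ultimately show ?thesis
            using J B a by (intro exI[of _ "J \<union> B"]) auto
        qed
      qed
    next
      case False
      have inj: "inj_on c I"
      proof (rule inj_onI, rule ccontr)
        fix x y assume "x \<in> I" "y \<in> I" "c x = c y" "x \<noteq> y"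
        then have "{x, y} \<subseteq> I \<and> {x, y} \<noteq> {} \<and> card {x, y} \<le> 2 \<and> sum c {x, y} = 0"
          by (simp add: char2)
        then show False using False by blast
      qed
      have nz: "0 \<notin> c ` I"
      proof
        assume "0 \<in> c ` I"
        then obtain x where "x \<in> I" "c x = 0" by auto
        then have "{x} \<subseteq> I \<and> {x} \<noteq> {} \<and> card {x} \<le> 2 \<and> sum c {x} = 0" by simp
        then show False using False by blast
      qed
      show ?thesis
      proof (cases "j = 0")
        case True
        then have "card A = k"
          using Suc.prems card_le[of A] by simp
        then have "A = ?E"
          by (intro card_subset_eq[OF finE A(1)]) (simp only: card_even_residues)
        moreover have "(2::nat) ^ 4 \<le> 2 ^ card I"
          using Suc.prems by (intro power_increasing) auto
        then have "\<exists>J\<subseteq>I. J \<noteq> {} \<and> sum c J = 0"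
          using fin card by (intro zero_sum_subset_if_double_eq_0) (auto simp: char2)
        ultimately show ?thesis
          using mod_E fin finite_subset by meson
      next
        case j: False
        have "card (c ` I) \<le> card (UNIV - {0 :: 'v})"
          using nz by (intro card_mono) auto
        then have cardI: "card I \<le> 7"
          using card inj by (simp add: card_image card_Diff_subset)
        then have j: "j = 1" and I6: "6 \<le> card I"
          using Suc.prems j by auto
        have "\<exists>p. p \<noteq> 0 \<and> UNIV - {0, p} \<subseteq> c ` I"
        proof -
          let ?S = "UNIV - {0} - c ` I"
          have "card ?S = 7 - card I"
            using nz inj card by (subst card_Diff_subset) (auto simp: card_image card_Diff_subset)
          then consider "?S = {}" | "card ?S = 1"
            using I6 by (cases "card I = 6") auto
          then show ?thesis
          proof cases
            case 1
            have "card (UNIV :: 'v set) \<noteq> card {0 :: 'v}"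
              using card by simp
            then have "UNIV \<noteq> {0 :: 'v}"
              by (rule contrapos_nn) (rule arg_cong)
            then show ?thesis
              using 1 by auto
          next
            case 2
            then obtain p where "?S = {p}"
              by (rule card_1_singletonE)
            then show ?thesis
              by (intro exI[of _ p]) blast
          qed
        qed
        then obtain p where p: "p \<noteq> 0" "UNIV - {0, p} \<subseteq> c ` I" by blast
        define e where "e = inv_into I c"
        have e: "e v \<in> I" "c (e v) = v" if "v \<in> UNIV - {0, p}" for v
          using that p(2) unfolding e_def by (meson in_mono inv_into_into f_inv_into_f)+
        \<comment> \<open>if no block of representatives \<open>e v\<close> is a solution, then all of them have the same sum,
          namely minus the only even residue outside \<open>A\<close>\<close>
        show ?thesis
        proof (rule ccontr)
          assume no: "\<not> ?thesis"
          have "card (?E - A) \<le> 1"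
            using Suc.prems(5) j unfolding card_Diff_subset[OF finA A(1)] card_even_residues by simp
          then have uniq: "x = y" if "x \<in> ?E - A" "y \<in> ?E - A" for x y
            using that card_le_Suc0_iff_eq[of "?E - A"] finE by auto
          have mem: "(- sum (f \<circ> e) T) mod ?M \<in> ?E - A"
            if T: "T \<subseteq> UNIV - {0, p}" "T \<noteq> {}" "\<Sum>T = 0" for T
          proof -
            have "inj_on e T"
              using e T by (metis (no_types, lifting) inj_on_def in_mono)
            then have s: "sum g (e ` T) = sum (g \<circ> e) T" for g :: "'i \<Rightarrow> 'x::comm_monoid_add"
              by (rule sum.reindex)
            have "sum (c \<circ> e) T = \<Sum>T"
              by (rule sum.cong) (use e T in auto)
            then have 0: "sum c (e ` T) = 0"
              using T by (simp add: s)
            have "e ` T \<subseteq> I" "e ` T \<noteq> {}"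
              using e T by auto
            then have "(- sum f (e ` T)) mod ?M \<notin> A"
              using no 0 by blast
            moreover have "(- sum f (e ` T)) mod ?M \<in> ?E"
              by (rule mod_E[OF _ 0]) simp
            ultimately show ?thesis
              unfolding s by (intro DiffI)
          qed
          obtain h where h: "?E - A \<subseteq> {h}" "h = 0 \<or> h \<in> ?E - A"
            \<comment> \<open>the default \<open>0\<close> covers the case in which no even residue is missing\<close>
          proof (cases "?E - A = {}")
            case True
            then show ?thesis using that[of 0] by blast
          next
            case False
            then obtain h where "h \<in> ?E - A" by blast
            then show ?thesis using that[of h] uniq by blast
          qed
          have "h mod ?M = 0"
          proof (rule six_point_configuration[OF char2 card p(1), of "f \<circ> e"])
            fix T assume "T \<subseteq> UNIV - {0, p}" "T \<noteq> {}" "\<Sum>T = 0"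
            then show "(- sum (f \<circ> e) T) mod ?M = h"
              using mem h by blast
          qed
          moreover have "0 \<le> h" "h < ?M"
            using h(2) k by auto
          ultimately have "h = 0"
            by simp
          \<comment> \<open>any single block contradicts this, because \<open>0\<close> lies in \<open>A\<close>\<close>
          obtain T where T: "T \<subseteq> UNIV - {0, p}" "T \<noteq> {}" "\<Sum>T = 0"
          proof -
            have "\<exists>J\<subseteq>UNIV - {0, p}. J \<noteq> {} \<and> \<Sum>J = 0"
              using card p by (intro zero_sum_subset_if_double_eq_0) (auto simp: char2 card_Diff_subset)
            then show ?thesis using that by blast
          qed
          then show False
            using subsetD[OF h(1) mem[OF T]] DiffD2[OF mem[OF T]] \<open>h = 0\<close> A(2) by simp
        qed
      qed
    qed
  }
qed

section \<open>Zero sums in elementary extensions of a cyclic group of even order\<close>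

lemma double_eq_0_mod_2: "2 * x = (0::2)" "x + x = (0::2)"
proof -
  have "(2::2) = 0" by simp
  then show "2 * x = 0" by (simp only: mult_zero_left)
  then show "x + x = 0" by (simp only: mult_2)
qed

lemma of_nat_mod_2_eq_0_iff: "of_nat n = (0::2) \<longleftrightarrow> even n"
proof (cases "even n")
  case True
  then show ?thesis by (auto elim!: evenE simp: double_eq_0_mod_2)
next
  case False
  then show ?thesis by (auto elim!: oddE simp: double_eq_0_mod_2)
qed

lemma of_int_mod_2_eq_0_iff: "of_int z = (0::2) \<longleftrightarrow> even z"
proof (cases "even z")
  case True
  then show ?thesis by (auto elim!: evenE simp: double_eq_0_mod_2)
next
  case False
  then show ?thesis by (auto elim!: oddE simp: double_eq_0_mod_2)
qed

text \<open>
  Before any block has been split off, the only sum available is the empty one: the target set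
  is \<open>{0}\<close>, and \<open>j = k\<close>.
\<close>

lemma zero_sum_C2_C2_C2k:
  fixes f :: "'i \<Rightarrow> int" and u v :: "'i \<Rightarrow> bool" and k :: nat
  assumes k: "k > 0" and I: "finite I" "2 * k + 2 \<le> card I"
  shows "\<exists>J\<subseteq>I. J \<noteq> {} \<and> 2 * int k dvd sum f J \<and> even (card {i \<in> J. u i}) \<and> even (card {i \<in> J. v i})"
proof -
  define c :: "'i \<Rightarrow> 2 \<times> 2 \<times> 2" where "c i = (of_int (f i), of_bool (u i), of_bool (v i))" for i
  have c0: "sum c J = 0 \<longleftrightarrow> even (sum f J) \<and> even (card {i \<in> J. u i}) \<and> even (card {i \<in> J. v i})"
    if "finite J" for J
    using that unfolding c_def sum_prod zero_prod_def prod.inject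
    by (simp add: of_int_mod_2_eq_0_iff of_nat_mod_2_eq_0_iff Int_def flip: of_int_sum)
  have "\<exists>J\<subseteq>I. J \<noteq> {} \<and> sum c J = 0 \<and> (- sum f J) mod (2 * int k) \<in> {0}"
  proof (rule zero_sum_subset_hitting[where j = k])
    show "x + x = 0" for x :: "2 \<times> 2 \<times> 2"
      by (cases x) (simp add: double_eq_0_mod_2 zero_prod_def)
    show "even (sum f J)" if "finite J" "sum c J = 0" for J
      using that c0 by blast
  qed (use k I in auto)
  then obtain J where J: "J \<subseteq> I" "J \<noteq> {}" "sum c J = 0" "(- sum f J) mod (2 * int k) = 0"
    by (elim exE conjE singletonE) (rule that)
  moreover have "2 * int k dvd sum f J"
    using mod_0_imp_dvd[OF J(4)] by (simp only: dvd_minus_iff)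
  ultimately show ?thesis
    using c0[of J] finite_subset[OF J(1) I(1)] by blast
qed

text \<open>
  A dummy term \<open>None\<close>, the only one with a non-zero entry in the second copy of $C_2$, reduces this
  to three components: the number of such terms in a zero sum is even, so \<open>None\<close> is not among them.
\<close>

lemma zero_sum_C2_C2k:
  fixes f :: "'i \<Rightarrow> int" and u :: "'i \<Rightarrow> bool" and k :: nat
  assumes k: "k > 0" and I: "finite I" "2 * k + 1 \<le> card I"
  shows "\<exists>J\<subseteq>I. J \<noteq> {} \<and> 2 * int k dvd sum f J \<and> even (card {i \<in> J. u i})"
proof -
  define f' where "f' = case_option 0 f"
  define u' where "u' = case_option False u"
  have "\<exists>J\<subseteq>insert None (Some ` I). J \<noteq> {} \<and> 2 * int k dvd sum f' J \<and>
      even (card {i \<in> J. u' i}) \<and> even (card {i \<in> J. i = None})"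
    using I k by (intro zero_sum_C2_C2_C2k) (auto simp: card_image)
  then obtain J where J: "J \<subseteq> insert None (Some ` I)" "J \<noteq> {}" "2 * int k dvd sum f' J"
      "even (card {i \<in> J. u' i})" "even (card {i \<in> J. i = None})"
    by blast
  have "None \<notin> J"
  proof
    assume "None \<in> J"
    then have "{i \<in> J. i = None} = {None}" by auto
    then show False using J(5) by simp
  qed
  then have "J \<subseteq> Some ` I" using J(1) by auto
  then obtain J' where J': "J' \<subseteq> I" "J = Some ` J'"
    by (meson subset_imageE)
  have "sum f' J = sum f J'"
    unfolding J' by (subst sum.reindex) (auto simp: f'_def)
  moreover have "{i \<in> J. u' i} = Some ` {i \<in> J'. u i}"
    unfolding J' by (auto simp: u'_def)
  then have "card {i \<in> J. u' i} = card {i \<in> J'. u i}"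
    by (simp add: card_image)
  moreover have "J' \<noteq> {}"
    using J(2) J'(2) by blast
  ultimately show ?thesis
    using J(3,4) J'(1) by (intro exI[of _ J']) simp
qed

section \<open>Cancellation by a choice of signs\<close>

text \<open>
  Modulo \<open>q\<close> the weights are signs, so each term can be turned into either of \<open>a\<close> and \<open>- a\<close>.
  Half of the terms are turned into \<open>a\<close> and the other half into \<open>- a\<close>.
\<close>

lemma weights_cancel_if_even:
  fixes x :: "'i \<Rightarrow> int" and q s a :: int
  assumes s: "[s = - 1] (mod q)" and J: "finite J" "even (card J)"
    and x: "\<And>i. i \<in> J \<Longrightarrow> [x i = a] (mod q) \<or> [x i = - a] (mod q)"
  shows "\<exists>w. (\<forall>i. w i \<in> {1, s}) \<and> [(\<Sum>i\<in>J. w i * x i) = 0] (mod q)"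
proof -
  obtain H where H: "H \<subseteq> J" "card H = card J div 2"
    using obtain_subset_with_card_n[of "card J div 2" J] by auto
  have fin: "finite H" using H J finite_subset by blast
  define w where "w i = (if [x i = (if i \<in> H then a else - a)] (mod q) then 1 else s)" for i
  have w: "[w i * x i = (if i \<in> H then a else - a)] (mod q)" if "i \<in> J" for i
  proof (cases "[x i = (if i \<in> H then a else - a)] (mod q)")
    case False
    then have "[x i = (if i \<in> H then - a else a)] (mod q)"
      using x[OF that] by auto
    from cong_mult[OF s this] show ?thesis
      using False by (auto simp: w_def split: if_splits)
  qed (simp add: w_def)
  have "[(\<Sum>i\<in>J. w i * x i) = (\<Sum>i\<in>J. if i \<in> H then a else - a)] (mod q)"
    using w by (intro cong_sum)
  also have "(\<Sum>i\<in>J. if i \<in> H then a else - a) = int (card H) * a - int (card (J - H)) * a"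
    using J H by (simp add: sum.If_cases Int_absorb1 Diff_eq[symmetric])
  also have "card (J - H) = card H"
    using J H fin by (auto simp: card_Diff_subset elim!: evenE)
  finally have "[(\<Sum>i\<in>J. w i * x i) = 0] (mod q)" by simp
  moreover have "\<forall>i. w i \<in> {1, s}" by (simp add: w_def)
  ultimately show ?thesis by blast
qed

text \<open>
  The non-zero residues that occur form the classes of \<open>1\<close> and \<open>2\<close> up to sign, and the terms of each
  class cancel among themselves. Removing \<open>{1, q - 1}\<close> from the second class matters for \<open>q = 3\<close>,
  where \<open>2 \<equiv> - 1\<close> and the two classes coincide.
\<close>

lemma weights_cancel_if_even_classes:
  fixes x :: "'i \<Rightarrow> int" and q s :: int
  assumes s: "[s = - 1] (mod q)" and J: "finite J"
    and x: "\<And>i. i \<in> J \<Longrightarrow> x i mod q \<in> {0, 1, q - 1, 2, q - 2}"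
    and u: "even (card {i \<in> J. x i mod q \<in> {1, q - 1}})"
    and v: "even (card {i \<in> J. x i mod q \<in> {2, q - 2} - {1, q - 1}})"
  shows "\<exists>w. (\<forall>i. w i \<in> {1, s}) \<and> q dvd (\<Sum>i\<in>J. w i * x i)"
proof -
  define U where "U = {i \<in> J. x i mod q \<in> {1, q - 1}}"
  define V where "V = {i \<in> J. x i mod q \<in> {2, q - 2} - {1, q - 1}}"
  have UV: "U \<subseteq> J" "V \<subseteq> J - U"
    by (auto simp: U_def V_def)
  have fin: "finite U" "finite V"
    using UV J by (meson finite_Diff finite_subset)+
  have m: "[y = a] (mod q)" if "y mod q = a \<or> y mod q = q + a" for y a
    using that by (metis cong_def mod_add_self1 mod_mod_trivial)
  have "\<exists>w. (\<forall>i. w i \<in> {1, s}) \<and> [(\<Sum>i\<in>U. w i * x i) = 0] (mod q)"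
  proof (rule weights_cancel_if_even[OF s, where a = 1])
    show "[x i = 1] (mod q) \<or> [x i = - 1] (mod q)" if "i \<in> U" for i
      using that m[of "x i" 1] m[of "x i" "-1"] by (auto simp: U_def)
  qed (use fin u in \<open>simp_all add: U_def\<close>)
  then obtain wU where wU: "\<And>i. wU i \<in> {1, s}" "[(\<Sum>i\<in>U. wU i * x i) = 0] (mod q)"
    by (elim exE conjE) (rule that, simp_all)
  have "\<exists>w. (\<forall>i. w i \<in> {1, s}) \<and> [(\<Sum>i\<in>V. w i * x i) = 0] (mod q)"
  proof (rule weights_cancel_if_even[OF s, where a = 2])
    show "[x i = 2] (mod q) \<or> [x i = - 2] (mod q)" if "i \<in> V" for i
      using that m[of "x i" 2] m[of "x i" "-2"] by (auto simp: V_def)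
  qed (use fin v in \<open>simp_all add: V_def\<close>)
  then obtain wV where wV: "\<And>i. wV i \<in> {1, s}" "[(\<Sum>i\<in>V. wV i * x i) = 0] (mod q)"
    by (elim exE conjE) (rule that, simp_all)
  define w where "w i = (if i \<in> U then wU i else wV i)" for i
  have "(\<Sum>i\<in>J. w i * x i) = (\<Sum>i\<in>J - U. w i * x i) + (\<Sum>i\<in>U. w i * x i)"
    by (rule sum.subset_diff[OF UV(1) J])
  also have "(\<Sum>i\<in>J - U. w i * x i) = (\<Sum>i\<in>J - U - V. w i * x i) + (\<Sum>i\<in>V. w i * x i)"
    by (rule sum.subset_diff[OF UV(2)]) (simp add: J)
  also have "(\<Sum>i\<in>U. w i * x i) = (\<Sum>i\<in>U. wU i * x i)"
    by (simp add: w_def)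
  also have "(\<Sum>i\<in>V. w i * x i) = (\<Sum>i\<in>V. wV i * x i)"
    using UV by (intro sum.cong) (auto simp: w_def)
  also have "[(\<Sum>i\<in>J - U - V. w i * x i) + (\<Sum>i\<in>V. wV i * x i) + (\<Sum>i\<in>U. wU i * x i) = 0 + 0 + 0] (mod q)"
  proof (intro cong_add wU wV)
    have "q dvd x i" if "i \<in> J - U - V" for i
      using that x[of i] by (auto simp: U_def V_def)
    then show "[(\<Sum>i\<in>J - U - V. w i * x i) = 0] (mod q)"
      unfolding cong_0_iff by (intro dvd_sum dvd_mult) blast
  qed
  finally have "q dvd (\<Sum>i\<in>J. w i * x i)"
    by (simp add: cong_0_iff)
  moreover have "\<forall>i. w i \<in> {1, s}"
    using wU(1) wV(1) by (simp add: w_def)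
  ultimately show ?thesis by blast
qed

section \<open>Weighted zero sums in the integers modulo n\<close>

lemma finprod_integer_mod_group:
  assumes "n > 0" "finite I"
  shows "finprod (integer_mod_group n) (\<lambda>i. x i [^]\<^bsub>integer_mod_group n\<^esub> (e i :: int)) I
    = (\<Sum>i\<in>I. e i * x i) mod int n"
  using assms(2)
proof induction
  case empty
  then show ?case
    by (simp add: comm_monoid.finprod_empty[OF comm_group.axioms(1)])
next
  case (insert i I)
  have "(\<lambda>i. x i [^]\<^bsub>integer_mod_group n\<^esub> (e i :: int)) \<in> I \<rightarrow> carrier (integer_mod_group n)" for I
    using \<open>n > 0\<close> by (auto simp: int_pow_integer_mod_group carrier_integer_mod_group)
  then show ?case
    using insert
    by (subst comm_monoid.finprod_insert[OF comm_group.axioms(1)])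
      (auto simp: int_pow_integer_mod_group mod_add_eq carrier_integer_mod_group)
qed

lemma has_weighted_zero_sum_integer_mod_group_iff:
  assumes "n > 0"
  shows "has_weighted_zero_sum A (integer_mod_group n) S \<longleftrightarrow>
    (\<exists>xs es. xs \<noteq> [] \<and> mset xs \<subseteq># S \<and> length es = length xs \<and> set es \<subseteq> A \<and>
        int n dvd (\<Sum>i<length xs. es ! i * xs ! i))"
  unfolding has_weighted_zero_sum_def
  by (simp add: finprod_integer_mod_group[OF assms] dvd_eq_mod_eq_0)

text \<open>
  Choosing a set of positions in a list is more convenient than choosing a sublist, because
  the weights are then a function on positions.
\<close>

lemma has_weighted_zero_sum_integer_mod_groupI:
  assumes n: "n > 0" and J: "J \<subseteq> {..<length ys}" "J \<noteq> {}" and w: "\<And>i. i \<in> J \<Longrightarrow> w i \<in> A"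
    and dvd: "int n dvd (\<Sum>i\<in>J. w i * ys ! i)"
  shows "has_weighted_zero_sum A (integer_mod_group n) (mset ys)"
proof -
  have fin: "finite J" using J finite_subset by blast
  let ?js = "sorted_list_of_set J"
  have "mset (map ((!) ys) ?js) = image_mset ((!) ys) (mset_set J)"
    using fin mset_set_set[of ?js] by simp
  also have "\<dots> \<subseteq># image_mset ((!) ys) (mset_set {..<length ys})"
    using J by (intro image_mset_subseteq_mono subset_imp_msubset_mset_set) auto
  also have "\<dots> = mset (map ((!) ys) [0..<length ys])"
    using mset_set_set[of "[0..<length ys]"] by (simp add: atLeast0LessThan)
  also have "\<dots> = mset ys" by (simp only: map_nth)
  finally have "mset (map ((!) ys) ?js) \<subseteq># mset ys" .
  moreover have "(\<Sum>i<length ?js. map w ?js ! i * map ((!) ys) ?js ! i) = (\<Sum>j\<in>J. w j * ys ! j)"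
  proof -
    have "(\<Sum>i<length ?js. map w ?js ! i * map ((!) ys) ?js ! i) = (\<Sum>j\<leftarrow>?js. w j * ys ! j)"
      by (simp add: sum_list_sum_nth atLeast0LessThan)
    also have "\<dots> = (\<Sum>j\<in>J. w j * ys ! j)"
      using fin by (simp add: sum_list_distinct_conv_sum_set)
    finally show ?thesis .
  qed
  ultimately show ?thesis
    unfolding has_weighted_zero_sum_integer_mod_group_iff[OF n]
    using J fin w dvd
    by (intro exI[of _ "map ((!) ys) ?js"] exI[of _ "map w ?js"]) auto
qed

lemma has_weighted_zero_sum_mono:
  "has_weighted_zero_sum A G S \<Longrightarrow> S \<subseteq># T \<Longrightarrow> has_weighted_zero_sum A G T"
  unfolding has_weighted_zero_sum_def by (meson subset_mset.order_trans)

text \<open>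
  One sequence without a weighted zero sum excludes all smaller lengths as well, since its
  subsequences have none either.
\<close>

lemma weighted_davenport_eqI:
  assumes d: "d > 0" and upper: "\<And>S. set_mset S \<subseteq> carrier G \<Longrightarrow> size S = d \<Longrightarrow> has_weighted_zero_sum A G S"
    and T: "set_mset T \<subseteq> carrier G" "size T + 1 = d" "\<not> has_weighted_zero_sum A G T"
  shows "weighted_davenport A G = d"
  unfolding weighted_davenport_def
proof (rule Least_equality)
  fix D assume D: "D > 0 \<and> (\<forall>S. set_mset S \<subseteq> carrier G \<and> size S = D \<longrightarrow> has_weighted_zero_sum A G S)"
  show "d \<le> D"
  proof (rule ccontr)
    assume "\<not> d \<le> D"
    obtain ys where ys: "mset ys = T" using ex_mset by blast
    have "mset (take D ys) \<subseteq># T"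
      using ys by (metis append_take_drop_id mset_append mset_subset_eq_add_left)
    moreover have "size (mset (take D ys)) = D"
      using \<open>\<not> d \<le> D\<close> T(2) ys by auto
    ultimately show False
      using D T has_weighted_zero_sum_mono by (metis set_mset_mono subset_trans)
  qed
qed (use d upper in auto)

text \<open>
  Modulo \<open>m\<close> all weights are \<open>1\<close> and the terms of \<open>R\<close> vanish, so a weighted zero sum contains a
  number of copies of \<open>e\<close> that is divisible by \<open>m\<close>. Only \<open>m - 1\<close> copies are present, hence none
  is used and the zero sum lies in \<open>R\<close>.
\<close>

lemma no_weighted_zero_sum_add_replicate:
  fixes n m :: nat and e s :: int
  assumes n: "n > 0" and m: "m > 0" "int m dvd int n"
    and A: "\<And>a. a \<in> A \<Longrightarrow> [a = 1] (mod int m)"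
    and e: "[e = 1] (mod int m)"
    and R: "\<And>x. x \<in># R \<Longrightarrow> int m dvd x" "\<not> has_weighted_zero_sum A (integer_mod_group n) R"
  shows "\<not> has_weighted_zero_sum A (integer_mod_group n) (R + replicate_mset (m - 1) e)"
proof
  assume "has_weighted_zero_sum A (integer_mod_group n) (R + replicate_mset (m - 1) e)"
  then obtain xs es where xs: "xs \<noteq> []" "mset xs \<subseteq># R + replicate_mset (m - 1) e"
      "length es = length xs" "set es \<subseteq> A" "int n dvd (\<Sum>i<length xs. es ! i * xs ! i)"
    unfolding has_weighted_zero_sum_integer_mod_group_iff[OF n] by blast
  have "mset xs - R \<subseteq># replicate_mset (m - 1) e"
    using xs(2) by (simp add: subset_eq_diff_conv add.commute)
  then obtain t where t: "t \<le> m - 1" "mset xs - R = replicate_mset t e"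
    by (metis msubseteq_replicate_msetE)
  have "0 = (\<Sum>i<length xs. es ! i * xs ! i) mod int m"
    using xs(5) m by (metis dvd_imp_mod_0 dvd_trans)
  also have "\<dots> = (\<Sum>i<length xs. 1 * xs ! i) mod int m"
  proof -
    have "[(\<Sum>i<length xs. es ! i * xs ! i) = (\<Sum>i<length xs. 1 * xs ! i)] (mod int m)"
      by (intro cong_sum cong_mult cong_refl A) (use xs in \<open>auto simp: subset_iff\<close>)
    then show ?thesis by (simp add: cong_def)
  qed
  also have "(\<Sum>i<length xs. 1 * xs ! i) = \<Sum>\<^sub># (mset xs)"
    by (simp add: sum_mset_sum_list sum_list_sum_nth atLeast0LessThan)
  also have "mset xs = (mset xs \<inter># R) + replicate_mset t e"
    by (metis t(2) diff_intersect_left_idem inter_subset_eq_union multiset_inter_commute subset_mset.add_diff_inverse subset_mset.inf.cobounded1 subset_mset.inf_commute)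
  also have "\<Sum>\<^sub># \<dots> = \<Sum>\<^sub># (mset xs \<inter># R) + int t * e"
    by (simp add: sum_mset_replicate_mset)
  also have "(\<dots>) mod int m = int t mod int m"
  proof -
    have "int m dvd \<Sum>\<^sub># (mset xs \<inter># R)"
    proof -
      have "int m dvd \<Sum>\<^sub># X" if "\<forall>x\<in>#X. int m dvd x" for X
        using that by (induction X) auto
      then show ?thesis using R(1) by simp
    qed
    moreover have "[int t * e = int t * 1] (mod int m)"
      by (intro cong_mult cong_refl e)
    ultimately have "[\<Sum>\<^sub># (mset xs \<inter># R) + int t * e = 0 + int t * 1] (mod int m)"
      by (intro cong_add) (auto simp: cong_0_iff)
    then show ?thesis by (simp add: cong_def)
  qed
  finally have "t = 0"
    using t m by simp
  then have "mset xs \<subseteq># R"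
    using t by (simp add: Diff_eq_empty_iff_mset)
  then show False
    using R(2) xs unfolding has_weighted_zero_sum_integer_mod_group_iff[OF n] by blast
qed

section \<open>Bounds for the weighted Davenport constant\<close>

text \<open>
  A term \<open>x\<close> is sent to $C_{2k}$ and to two copies of $C_2$ that record whether \<open>x\<close> is \<open>\<plusminus> 1\<close> or
  \<open>\<plusminus> 2\<close> modulo \<open>n1\<close>. A zero sum of these images has sum \<open>0\<close> modulo \<open>2 * k\<close>, which does not
  see the weights, and its terms cancel in pairs modulo \<open>n1\<close>. For \<open>n1 = 3\<close> the second copy of
  $C_2$ is trivially \<open>0\<close>, which saves one term.
\<close>

lemma has_weighted_zero_sum_if_long:
  fixes n1 k :: nat and s :: int
  assumes n1: "n1 \<in> {3, 5}" and k: "k > 0" and co: "coprime n1 (2 * k)"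
    and s: "[s = - 1] (mod int n1)" "[s = 1] (mod int (2 * k))"
    and S: "size S = 2 * k + (if n1 = 3 then 1 else 2)"
  shows "has_weighted_zero_sum {1, s} (integer_mod_group (n1 * (2 * k))) S"
proof -
  let ?q = "int n1"
  obtain ys where ys: "mset ys = S" using ex_mset by blast
  let ?I = "{..<length ys}"
  let ?u = "\<lambda>i. ys ! i mod ?q \<in> {1, ?q - 1}" and ?v = "\<lambda>i. ys ! i mod ?q \<in> {2, ?q - 2} - {1, ?q - 1}"
  have len: "length ys = 2 * k + (if n1 = 3 then 1 else 2)"
    using S ys by auto
  have "\<exists>J\<subseteq>?I. J \<noteq> {} \<and> 2 * int k dvd (\<Sum>i\<in>J. ys ! i) \<and> even (card {i \<in> J. ?u i}) \<and> even (card {i \<in> J. ?v i})"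
  proof (cases "n1 = 3")
    case True
    then have "\<exists>J\<subseteq>?I. J \<noteq> {} \<and> 2 * int k dvd (\<Sum>i\<in>J. ys ! i) \<and> even (card {i \<in> J. ?u i})"
      using k len by (intro zero_sum_C2_C2k) auto
    moreover have no_v: "{i \<in> J. ?v i} = {}" for J
      using True by auto
    have "even (card {i \<in> J. ?v i})" for J
      unfolding no_v by simp
    ultimately show ?thesis by blast
  next
    case False
    then show ?thesis
      using k len by (intro zero_sum_C2_C2_C2k) auto
  qed
  then obtain J where J: "J \<subseteq> ?I" "J \<noteq> {}" "2 * int k dvd (\<Sum>i\<in>J. ys ! i)"
    and even: "even (card {i \<in> J. ?u i})" "even (card {i \<in> J. ?v i})"
    by (elim exE conjE) (rule that)
  have "x mod ?q \<in> {0, 1, ?q - 1, 2, ?q - 2}" for x :: int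
  proof -
    have "0 \<le> x mod ?q" "x mod ?q < ?q" using n1 by auto
    then show ?thesis using n1 by auto
  qed
  moreover have "finite J" using J finite_subset by blast
  ultimately have "\<exists>w. (\<forall>i. w i \<in> {1, s}) \<and> ?q dvd (\<Sum>i\<in>J. w i * ys ! i)"
    using n1 even by (intro weights_cancel_if_even_classes s) auto
  then obtain w where w: "\<And>i. w i \<in> {1, s}" "?q dvd (\<Sum>i\<in>J. w i * ys ! i)"
    by (elim exE conjE) (rule that, simp_all)
  have "[(\<Sum>i\<in>J. w i * ys ! i) = (\<Sum>i\<in>J. 1 * ys ! i)] (mod int (2 * k))"
  proof (intro cong_sum cong_mult cong_refl)
    show "[w i = 1] (mod int (2 * k))" for i
      using w(1)[of i] s(2) by auto
  qed
  then have "int (2 * k) dvd (\<Sum>i\<in>J. w i * ys ! i)"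
    using J(3) by (simp add: cong_dvd_iff)
  moreover have "coprime ?q (int (2 * k))"
    using co by (simp only: coprime_int_iff)
  ultimately have "int (n1 * (2 * k)) dvd (\<Sum>i\<in>J. w i * ys ! i)"
    using w(2) divides_mult by (metis of_nat_mult)
  then show ?thesis
    unfolding ys[symmetric]
    using n1 k J(1,2) w(1) by (intro has_weighted_zero_sum_integer_mod_groupI[where J = J and w = w]) auto
qed

lemma ex_residue_with_components:
  assumes "coprime n1 n2" "n1 > 0" "n2 > 0"
  obtains x where "x \<in> carrier (integer_mod_group (n1 * n2))"
    "[x = int a] (mod int n1)" "[x = int b] (mod int n2)"
proof -
  obtain y where y: "y < n1 * n2" "[y = a] (mod n1)" "[y = b] (mod n2)"
    using binary_chinese_remainder_unique_nat[of n1 n2 a b] assms by auto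
  then show ?thesis
    using assms by (intro that[of "int y"]) (auto simp: carrier_integer_mod_group cong_int_iff simp flip: of_nat_mult)
qed

lemma mod_sum_of_products:
  fixes e x e' y m :: int
  shows "(e * x + e' * y) mod m = ((e mod m) * (x mod m) + (e' mod m) * (y mod m)) mod m"
  by (intro mod_add_cong mod_mult_cong) simp_all

lemma no_weighted_zero_sum_3:
  assumes "n > 0" "3 dvd n" "[s = - 1] (mod 3)" "[a = 1] (mod 3)"
  shows "\<not> has_weighted_zero_sum {1, s} (integer_mod_group n) {#a#}"
proof
  assume "has_weighted_zero_sum {1, s} (integer_mod_group n) {#a#}"
  then obtain xs es where xs: "xs \<noteq> []" "mset xs \<subseteq># {#a#}" "length es = length xs" "set es \<subseteq> {1, s}"
    "int n dvd (\<Sum>i<length xs. es ! i * xs ! i)"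
    unfolding has_weighted_zero_sum_integer_mod_group_iff[OF assms(1)] by blast
  have "xs = [a]"
    using xs(1,2) size_mset_mono[OF xs(2)] by (cases xs; cases "tl xs") auto
  moreover from this obtain e where "es = [e]" "e \<in> {1, s}"
    using xs(3,4) by (cases es) auto
  moreover have "(3::int) dvd int n"
    using assms(2) by presburger
  ultimately have "e * a mod 3 = 0" "e mod 3 \<in> {1, 2}" "a mod 3 = 1"
    using xs(5) assms(3,4) dvd_trans by (auto simp: cong_def)
  moreover have "e * a mod 3 = (e mod 3) * (a mod 3) mod 3"
    by (simp add: mod_simps)
  ultimately show False by auto
qed

text \<open>
  The possible weighted sums are \<open>\<plusminus> 1\<close>, \<open>\<plusminus> 2\<close> and \<open>\<plusminus> 1 \<plusminus> 2\<close>, none of which vanishes modulo \<open>5\<close>.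
\<close>

lemma no_weighted_zero_sum_5:
  assumes "n > 0" "5 dvd n" "[s = - 1] (mod 5)" "[a = 1] (mod 5)" "[b = 2] (mod 5)"
  shows "\<not> has_weighted_zero_sum {1, s} (integer_mod_group n) {#a, b#}"
proof
  assume "has_weighted_zero_sum {1, s} (integer_mod_group n) {#a, b#}"
  then obtain xs es where xs: "xs \<noteq> []" "mset xs \<subseteq># {#a, b#}" "length es = length xs" "set es \<subseteq> {1, s}"
    "int n dvd (\<Sum>i<length xs. es ! i * xs ! i)"
    unfolding has_weighted_zero_sum_integer_mod_group_iff[OF assms(1)] by blast
  have dvd: "5 dvd (\<Sum>i<length xs. es ! i * xs ! i)"
  proof -
    have "5 dvd int n"
      using assms(2) by presburger
    then show ?thesis using xs(5) by (rule dvd_trans)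
  qed
  have ab: "a mod 5 = 1" "b mod 5 = 2"
    using assms by (simp_all add: cong_def)
  have e5: "e mod 5 \<in> {1, 4}" if "e \<in> set es" for e
    using that xs(4) assms(3) by (auto simp: cong_def)
  have "length xs \<le> 2"
    using size_mset_mono[OF xs(2)] by simp
  then consider x where "xs = [x]" | x y where "xs = [x, y]"
    using xs(1) by (cases xs; cases "tl xs") auto
  then show False
  proof cases
    case 1
    then have "x mod 5 \<in> {1, 2}"
      using xs(2) ab by (auto dest: mset_subset_eqD)
    moreover obtain e where "es = [e]"
      using xs(3) 1 by (cases es) auto
    ultimately show False
      using dvd e5[of e] 1 mod_sum_of_products[of e x 0 0 5] by auto
  next
    case 2
    then have "mset xs = {#a, b#}"
      using subset_mset.le_imp_less_or_eq[OF xs(2)] by (auto dest: mset_subset_size)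
    then have "(x = a \<and> y = b) \<or> (x = b \<and> y = a)"
      using 2 by (auto simp: add_eq_conv_ex)
    then have xy: "(x mod 5, y mod 5) \<in> {(1, 2), (2, 1)}"
      using ab by auto
    obtain e e' where es: "es = [e, e']"
      using xs(3) 2 by (cases es; cases "tl es") auto
    have "(e * x + e' * y) mod 5 = 0"
      using dvd es 2 by (simp add: dvd_eq_mod_eq_0)
    then show False
      using xy e5[of e] e5[of e'] es mod_sum_of_products[of e x e' y 5] by auto
  qed
qed

theorem proposition6p3:
  fixes n n1 n2 :: nat and s :: int
  assumes "n > 0" and "s > 0"
    and "[s ^ 2 = 1] (mod int n)"
    and "\<not> [s = 1] (mod int n)" and "\<not> [s = - 1] (mod int n)"
    and "n = n1 * n2" and "n1 \<ge> 3" and "n2 \<ge> 3" and "coprime n1 n2"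
    and "[s = - 1] (mod int n1)" and "[s = 1] (mod int n2)"
    and "n1 \<in> {3, 5}" and "even n2"
  shows "int (weighted_davenport {1, s} (integer_mod_group n)) = int n2 + \<lfloor>log 2 (real n1)\<rfloor>"
proof -
  note n = \<open>n = n1 * n2\<close> and s1 = \<open>[s = - 1] (mod int n1)\<close> and s2 = \<open>[s = 1] (mod int n2)\<close>
  obtain k where k: "n2 = 2 * k"
    using \<open>even n2\<close> by blast
  define r :: nat where "r = (if n1 = 3 then 1 else 2)"
  have log: "\<lfloor>log 2 (real n1)\<rfloor> = int r"
    using \<open>n1 \<in> {3, 5}\<close> floor_log_nat_eq_powr_iff[of 2 n1 r] by (auto simp: r_def)
  obtain e where e: "e \<in> carrier (integer_mod_group n)" "[e = int 0] (mod int n1)" "[e = int 1] (mod int n2)"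
    using ex_residue_with_components[of n1 n2 0 1] assms by auto
  obtain a where a: "a \<in> carrier (integer_mod_group n)" "[a = int 1] (mod int n1)" "[a = int 0] (mod int n2)"
    using ex_residue_with_components[of n1 n2 1 0] assms by auto
  obtain b where b: "b \<in> carrier (integer_mod_group n)" "[b = int 2] (mod int n1)" "[b = int 0] (mod int n2)"
    using ex_residue_with_components[of n1 n2 2 0] assms by auto
  \<comment> \<open>\<open>e\<close>, \<open>a\<close>, \<open>b\<close> are \<open>(0, 1)\<close>, \<open>(1, 0)\<close>, \<open>(2, 0)\<close> in $C_{n_1} \<oplus> C_{n_2}$; the extremal sequence
    consists of \<open>n2 - 1\<close> copies of \<open>e\<close>, of \<open>a\<close>, and for \<open>n1 = 5\<close> also of \<open>b\<close>\<close>
  define R where "R = (if n1 = 3 then {#a#} else {#a, b#})"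
  have R: "\<not> has_weighted_zero_sum {1, s} (integer_mod_group n) R"
  proof (cases "n1 = 3")
    case True
    then show ?thesis
      using no_weighted_zero_sum_3[of n s a] \<open>n > 0\<close> n s1 a by (simp add: R_def)
  next
    case False
    then have "n1 = 5" using \<open>n1 \<in> {3, 5}\<close> by simp
    then show ?thesis
      using no_weighted_zero_sum_5[of n s a b] \<open>n > 0\<close> n s1 a b by (simp add: R_def)
  qed
  have "weighted_davenport {1, s} (integer_mod_group n) = n2 + r"
  proof (rule weighted_davenport_eqI)
    show "has_weighted_zero_sum {1, s} (integer_mod_group n) S" if "size S = n2 + r" for S
      using has_weighted_zero_sum_if_long[of n1 k s S] that assms k by (simp add: r_def)
    show "\<not> has_weighted_zero_sum {1, s} (integer_mod_group n) (R + replicate_mset (n2 - 1) e)"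
      using assms s2 e R a b
      by (intro no_weighted_zero_sum_add_replicate) (auto simp: R_def cong_0_iff split: if_splits)
    show "set_mset (R + replicate_mset (n2 - 1) e) \<subseteq> carrier (integer_mod_group n)"
      using a b e by (auto simp: R_def split: if_splits)
    show "size (R + replicate_mset (n2 - 1) e) + 1 = n2 + r" "n2 + r > 0"
      using \<open>n2 \<ge> 3\<close> by (simp_all add: R_def r_def)
  qed
  then show ?thesis
    using log by simp
qed

end
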